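(* Let $f(x)=\sum_{n=0}^{\infty}x^n a_n\in \mathcal{SRB}(\mathbb{B})$ with $a_n\in\mathbb{O}$. Then for all $x\in\mathbb{B}$ with $0<|x|<1$, $$\mathcal{L}^*_f(|x|):=\sum_{n=0}^{\infty}|x|^n\left(\sum_{k=0}^{n}\frac{|a_k|}{(n+1)^{k+1}}\right)\le\frac{1}{|x|}\log\frac{1}{1-|x|}.$$
   Context: $\mathbb{O}$ is the real algebra of octonions, $\mathbb{O}=\mathbb{H}+l\mathbb{H}$ ($\mathbb{H}$ the quaternions) with $\overline{a+lb}=\overline a-lb$ and $(a+lb)(c+ld)=(ac-d\overline b)+l(\overline a d+cb)$, a non-commutative, non-associative, alternative division algebra. $|x|=\sqrt{x\overline x}$ is the Euclidean norm on $\mathbb{R}^8$; it is multiplicative. $\mathbb{B}=\{x\in\mathbb{O}:|x|<1\}$, $\mathbb{S}=\{I\in\mathbb{O}:I^2=-1\}$, and $\mathbb{D}$ is the open unit disk of $\mathbb{C}$. Slice regular functions on $\mathbb{B}$: a stem function on $\mathbb{D}$ is $F=F_1+iF_2:\mathbb{D}\to\mathbb{O}\otimes_{\mathbb{R}}\mathbb{C}$ with $\mathbb{O}$-valued components satisfying $F_1(\overline z)=F_1(z)$, $F_2(\overline z)=-F_2(z)$. It induces the slice function $f:\mathbb{B}\to\mathbb{O}$, $f(\alpha+I\beta)=F_1(\alpha+i\beta)+I F_2(\alpha+i\beta)$ for $I\in\mathbb{S}$ and real $\alpha,\beta$ with $\alpha+i\beta\in\mathbb{D}$. The function $f$ is slice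 regular if $F$ is $C^1$ and satisfies the Cauchy–Riemann equations $\partial_\alpha F_1=\partial_\beta F_2$, $\partial_\beta F_1=-\partial_\alpha F_2$ on $\mathbb{D}$. Every slice regular function on $\mathbb{B}$ has a convergent power series expansion $f(x)=\sum_{k=0}^\infty x^k a_k$ with $a_k\in\mathbb{O}$. $\mathcal{SRB}(\mathbb{B})$ is the class of slice regular functions $f$ on $\mathbb{B}$ with $|f(x)|\le 1$ for all $x\in\mathbb{B}$. *)

theory Defs
  imports "HOL-Analysis.Analysis"
begin

section \<open>Quaternions\<close>

datatype quat = Quat (q0: real) (q1: real) (q2: real) (q3: real)

lemma quat_eq_iff: "x = y \<longleftrightarrow> q0 x = q0 y \<and> q1 x = q1 y \<and> q2 x = q2 y \<and> q3 x = q3 y"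
  by (cases x; cases y) auto

instantiation quat :: real_inner
begin

definition "0 = Quat 0 0 0 0"
definition "- x = Quat (- q0 x) (- q1 x) (- q2 x) (- q3 x)"
definition "x + y = Quat (q0 x + q0 y) (q1 x + q1 y) (q2 x + q2 y) (q3 x + q3 y)"
definition "x - y = Quat (q0 x - q0 y) (q1 x - q1 y) (q2 x - q2 y) (q3 x - q3 y)"
definition "r *\<^sub>R x = Quat (r * q0 x) (r * q1 x) (r * q2 x) (r * q3 x)"
definition inner_quat_def:
  "inner x y = q0 x * q0 y + q1 x * q1 y + q2 x * q2 y + q3 x * q3 y"
definition norm_quat_def: "norm (x::quat) = sqrt (inner x x)"
definition dist_quat_def: "dist x y = norm (x - y :: quat)"
definition uniformity_quat_def [code del]:
  "(uniformity :: (quat \<times> quat) filter) = (INF e\<in>{0 <..}. principal {(x, y). dist x y < e})"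
definition open_quat_def [code del]:
  "open (U :: quat set) \<longleftrightarrow> (\<forall>x\<in>U. eventually (\<lambda>(x', y). x' = x \<longrightarrow> y \<in> U) uniformity)"
definition sgn_quat_def: "sgn x = inverse (norm x) *\<^sub>R (x :: quat)"

lemmas quat_linear_defs =
  zero_quat_def uminus_quat_def plus_quat_def minus_quat_def scaleR_quat_def

instance
proof
  fix x :: quat
  show "(inner x x = 0) = (x = 0)"
    by (simp add: inner_quat_def zero_quat_def quat_eq_iff add_nonneg_eq_0_iff)
qed (simp_all add: quat_linear_defs inner_quat_def quat_eq_iff algebra_simps
       uniformity_quat_def open_quat_def sgn_quat_def dist_quat_def norm_quat_def)

end

instantiation quat :: ring_1
begin

definition "1 = Quat 1 0 0 0"
definition times_quat_def: "x * y = Quat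
  (q0 x * q0 y - q1 x * q1 y - q2 x * q2 y - q3 x * q3 y)
  (q0 x * q1 y + q1 x * q0 y + q2 x * q3 y - q3 x * q2 y)
  (q0 x * q2 y - q1 x * q3 y + q2 x * q0 y + q3 x * q1 y)
  (q0 x * q3 y + q1 x * q2 y - q2 x * q1 y + q3 x * q0 y)"

instance
  by standard (simp_all add: quat_linear_defs one_quat_def times_quat_def quat_eq_iff algebra_simps)

end

definition qcnj :: "quat \<Rightarrow> quat" where
  "qcnj x = Quat (q0 x) (- q1 x) (- q2 x) (- q3 x)"


section \<open>Octonions\<close>

text \<open>\<open>Octo a b\<close> stands for the octonion $a + l b$ with $a, b$ quaternions.\<close>

datatype octo = Octo (hfst: quat) (hsnd: quat)

lemma octo_eq_iff: "x = y \<longleftrightarrow> hfst x = hfst y \<and> hsnd x = hsnd y"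
  by (cases x; cases y) auto

instantiation octo :: real_inner
begin

definition "0 = Octo 0 0"
definition "- x = Octo (- hfst x) (- hsnd x)"
definition "x + y = Octo (hfst x + hfst y) (hsnd x + hsnd y)"
definition "x - y = Octo (hfst x - hfst y) (hsnd x - hsnd y)"
definition "r *\<^sub>R x = Octo (r *\<^sub>R hfst x) (r *\<^sub>R hsnd x)"
definition inner_octo_def: "inner x y = inner (hfst x) (hfst y) + inner (hsnd x) (hsnd y)"
definition norm_octo_def: "norm (x::octo) = sqrt (inner x x)"
definition dist_octo_def: "dist x y = norm (x - y :: octo)"
definition uniformity_octo_def [code del]:
  "(uniformity :: (octo \<times> octo) filter) = (INF e\<in>{0 <..}. principal {(x, y). dist x y < e})"
definition open_octo_def [code del]:
  "open (U :: octo set) \<longleftrightarrow> (\<forall>x\<in>U. eventually (\<lambda>(x', y). x' = x \<longrightarrow> y \<in> U) uniformity)"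
definition sgn_octo_def: "sgn x = inverse (norm x) *\<^sub>R (x :: octo)"

lemmas octo_linear_defs =
  zero_octo_def uminus_octo_def plus_octo_def minus_octo_def scaleR_octo_def

instance
proof
  fix x :: octo
  show "(inner x x = 0) = (x = 0)"
    by (simp add: inner_octo_def zero_octo_def octo_eq_iff add_nonneg_eq_0_iff)
qed (simp_all add: octo_linear_defs inner_octo_def octo_eq_iff algebra_simps
       inner_commute inner_add_left uniformity_octo_def open_octo_def sgn_octo_def dist_octo_def norm_octo_def)

end

text \<open>The multiplication is not associative, so only the syntactic class \<^class>\<open>power\<close> is
  available; \<open>x ^ n\<close> is then \<open>x * (x * (\<dots> * 1))\<close>, which by power-associativity does
  not depend on the bracketing.\<close>

instantiation octo :: power
begin

definition "1 = Octo 1 0"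
definition times_octo_def: "x * y = Octo
  (hfst x * hfst y - hsnd y * qcnj (hsnd x))
  (qcnj (hfst x) * hsnd y + hfst y * hsnd x)"

instance ..

end

definition ocnj :: "octo \<Rightarrow> octo" where
  "ocnj x = Octo (qcnj (hfst x)) (- hsnd x)"

lemma octo_mult_ocnj: "x * ocnj x = (norm x)\<^sup>2 *\<^sub>R 1"
  by (simp add: norm_octo_def inner_octo_def inner_quat_def times_octo_def ocnj_def qcnj_def
      one_octo_def scaleR_octo_def quat_linear_defs one_quat_def times_quat_def
      octo_eq_iff quat_eq_iff algebra_simps)

lemma norm_octo_mult: "norm (x * y) = norm x * norm (y::octo)"
  unfolding norm_octo_def real_sqrt_mult [symmetric]
  by (simp add: inner_octo_def inner_quat_def times_octo_def qcnj_def
      quat_linear_defs times_quat_def algebra_simps)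

definition imag_units :: "octo set" where
  "imag_units = {I. I * I = - 1}"


section \<open>Slice regular functions on the unit ball\<close>

text \<open>The complexification $\mathbb{O} \otimes_{\mathbb{R}} \mathbb{C}$ is represented by pairs of
  octonions, so a stem function $F_1 + i F_2$ is given by its two components. Functions on
  the disc or on the ball are total here; their values outside are never used.\<close>

definition stem_function :: "(complex \<Rightarrow> octo) \<Rightarrow> (complex \<Rightarrow> octo) \<Rightarrow> bool" where
  "stem_function F1 F2 \<longleftrightarrow>
     (\<forall>z\<in>ball 0 1. F1 (cnj z) = F1 z \<and> F2 (cnj z) = - F2 z)"

definition induces_slice_function ::
  "(complex \<Rightarrow> octo) \<Rightarrow> (complex \<Rightarrow> octo) \<Rightarrow> (octo \<Rightarrow> octo) \<Rightarrow> bool" where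
  "induces_slice_function F1 F2 f \<longleftrightarrow>
     (\<forall>I\<in>imag_units. \<forall>\<alpha> \<beta>. Complex \<alpha> \<beta> \<in> ball 0 1 \<longrightarrow>
        f (\<alpha> *\<^sub>R 1 + \<beta> *\<^sub>R I) = F1 (Complex \<alpha> \<beta>) + I * F2 (Complex \<alpha> \<beta>))"

definition C1_on :: "complex set \<Rightarrow> (complex \<Rightarrow> octo) \<Rightarrow> bool" where
  "C1_on U F \<longleftrightarrow>
     (\<exists>F'. (\<forall>z\<in>U. (F has_derivative blinfun_apply (F' z)) (at z)) \<and> continuous_on U F')"

definition partial_re :: "(complex \<Rightarrow> octo) \<Rightarrow> complex \<Rightarrow> octo" where
  "partial_re F z = vector_derivative (\<lambda>t. F (Complex t (Im z))) (at (Re z))"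

definition partial_im :: "(complex \<Rightarrow> octo) \<Rightarrow> complex \<Rightarrow> octo" where
  "partial_im F z = vector_derivative (\<lambda>t. F (Complex (Re z) t)) (at (Im z))"

definition slice_regular :: "(octo \<Rightarrow> octo) \<Rightarrow> bool" where
  "slice_regular f \<longleftrightarrow>
     (\<exists>F1 F2. stem_function F1 F2 \<and> induces_slice_function F1 F2 f \<and>
        C1_on (ball 0 1) F1 \<and> C1_on (ball 0 1) F2 \<and>
        (\<forall>z\<in>ball 0 1. partial_re F1 z = partial_im F2 z \<and> partial_im F1 z = - partial_re F2 z))"

definition SRB :: "(octo \<Rightarrow> octo) set" where
  "SRB = {f. slice_regular f \<and> (\<forall>x\<in>ball 0 1. norm (f x) \<le> 1)}"

end

theory Submission
  imports Defs
begin

text \<open>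
  Comparing coefficients of powers of \<open>norm x\<close> with those of
  $\frac{1}{r}\log\frac{1}{1-r} = \sum_n \frac{r^n}{n+1}$, it suffices to show
  $\sum_{k\le n} |a_k| (n+1)^{-k} \le 1$ for every $n$, and this follows from
  $|a_k| \le 2(1-|a_0|)$ for $k \ge 1$. To get the latter, choose an imaginary unit $I$ such that
  $a_0$ and $a_k$ lie on a common line of the left $\mathbb{C}_I$-vector space $\mathbb{O}$. Projecting
  $f|_{\mathbb{C}_I}$ to this line gives a complex power series with real part at most $1$, whose
  coefficients are estimated by integration against the kernel $1 + \cos(k\theta + \varphi) \ge 0$.
\<close>

section \<open>Coefficient estimates for complex power series with bounded real part\<close>

lemma has_integral_cos_period:
  "((\<lambda>t. cos (of_int l * t + c)) has_integral (if l = 0 then 2 * pi * cos c else 0)) {0..2 * pi}"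
proof (cases "l = 0")
  case True
  then show ?thesis
    using has_integral_const_real [of "cos c" 0 "2 * pi"] by simp
next
  case False
  have "((\<lambda>t. cos (of_int l * t + c)) has_integral
      sin (of_int l * (2 * pi) + c) / of_int l - sin (of_int l * 0 + c) / of_int l) {0..2 * pi}"
    using False
    by (intro fundamental_theorem_of_calculus)
       (auto intro!: derivative_eq_intros simp: has_real_derivative_iff_has_vector_derivative [symmetric])
  moreover have "sin (of_int l * (2 * pi) + c) = sin c"
    using sin_int_2pin [of l] cos_int_2pin [of l] by (simp add: sin_add mult_ac)
  ultimately show ?thesis
    using False by simp
qed

text \<open>By product-to-sum the integrand has frequencies \<open>m\<close>, \<open>m + k\<close>
  and \<open>m - k\<close>. As \<open>k > 0\<close>, the frequency \<open>m + k\<close> never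
  vanishes, so only \<open>m = 0\<close> and \<open>m = k\<close> leave a contribution.\<close>

lemma has_integral_cos_kernel:
  assumes "k > 0"
  shows "((\<lambda>t. cos (real m * t + c) * (1 + cos (real k * t + d))) has_integral
    (if m = 0 then 2 * pi * cos c else if m = k then pi * cos (c - d) else 0)) {0..2 * pi}"
proof -
  have eq: "cos (real m * t + c) * (1 + cos (real k * t + d)) =
      cos (of_int (int m) * t + c) + (cos (of_int (int m + int k) * t + (c + d)) / 2
        + cos (of_int (int m - int k) * t + (c - d)) / 2)" for t
    by (simp add: algebra_simps cos_times_cos add_divide_distrib)
  show ?thesis
    unfolding eq
    by (rule has_integral_eq_rhs [OF has_integral_add [OF has_integral_cos_period
            has_integral_add [OF has_integral_divide [OF has_integral_cos_period]
              has_integral_divide [OF has_integral_cos_period]]]])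
       (use assms in auto)
qed

text \<open>A Borel-Caratheodory type estimate. The kernel \<open>1 + cos (k * t + d)\<close> is
  nonnegative with total mass \<open>2 * pi\<close>, and integrating against it keeps only the
  coefficients \<open>c 0\<close> and \<open>c k\<close>. The phase \<open>d = Arg (c k)\<close>
  turns the contribution of \<open>c k\<close> into its modulus.\<close>

lemma Re_bounded_imp_coeff_bound:
  fixes c :: "nat \<Rightarrow> complex"
  assumes sm: "summable (\<lambda>m. norm (c m))"
    and le: "\<And>t. Re (\<Sum>m. c m * cis (real m * t)) \<le> B"
    and k: "k > 0"
  shows "norm (c k) \<le> 2 * (B - Re (c 0))"
proof -
  define d where "d = Arg (c k)"
  have polar: "Re (c m * cis s) = norm (c m) * cos (s + Arg (c m))" for m s
  proof -
    have "c m * cis s = rcis (norm (c m)) (Arg (c m)) * rcis 1 s"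
      by (simp add: rcis_cmod_Arg cis_rcis_eq)
    then show ?thesis
      by (simp add: rcis_mult Re_rcis add.commute)
  qed
  have main: "Re (c 0) + norm (c k) / 2 \<le> B + e" if e: "e > 0" for e
  proof -
    obtain M0 where M0: "\<And>n. n \<ge> M0 \<Longrightarrow> norm (\<Sum>m. norm (c (m + n))) < e"
      using suminf_exist_split [OF e sm] by blast
    \<comment> \<open>Working with a partial sum avoids interchanging series and integral:
      \<open>M0\<close> makes the tail smaller than \<open>e\<close>, and \<open>k + 1\<close> puts
      the indices \<open>0\<close> and \<open>k\<close> below \<open>M\<close>.\<close>
    define M where "M = M0 + k + 1"
    define S where "S t = (\<Sum>m<M. Re (c m * cis (real m * t)))" for t
    have S_le: "S t \<le> B + e" for t
    proof -
      have sm': "summable (\<lambda>m. norm (c m * cis (real m * t)))"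
        using sm by (simp add: norm_mult)
      have "(\<Sum>m. c m * cis (real m * t))
          = (\<Sum>m. c (m + M) * cis (real (m + M) * t)) + (\<Sum>m<M. c m * cis (real m * t))"
        by (rule suminf_split_initial_segment [OF summable_norm_cancel [OF sm']])
      moreover have "norm (\<Sum>m. c (m + M) * cis (real (m + M) * t)) \<le> (\<Sum>m. norm (c (m + M)))"
        using summable_norm [OF summable_ignore_initial_segment [OF sm', of M]]
        by (simp add: norm_mult)
      moreover have "(\<Sum>m. norm (c (m + M))) < e"
        using M0 [of M] by (simp add: M_def)
      moreover have "S t = Re (\<Sum>m<M. c m * cis (real m * t))"
        by (simp add: S_def)
      ultimately show ?thesis
        using le [of t] abs_Re_le_cmod [of "\<Sum>m. c (m + M) * cis (real (m + M) * t)"] by simp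
    qed
    have "((\<lambda>t. \<Sum>m<M. norm (c m) * (cos (real m * t + Arg (c m)) * (1 + cos (real k * t + d))))
        has_integral (\<Sum>m<M. norm (c m) * (if m = 0 then 2 * pi * cos (Arg (c m))
          else if m = k then pi * cos (Arg (c m) - d) else 0))) {0..2 * pi}"
      by (intro has_integral_sum finite_lessThan has_integral_mult_right has_integral_cos_kernel k)
    also have "(\<lambda>t. \<Sum>m<M. norm (c m) * (cos (real m * t + Arg (c m)) * (1 + cos (real k * t + d))))
        = (\<lambda>t. S t * (1 + cos (real k * t + d)))"
      unfolding S_def polar by (simp add: sum_distrib_right mult.assoc)
    also have "(\<Sum>m<M. norm (c m) * (if m = 0 then 2 * pi * cos (Arg (c m))
          else if m = k then pi * cos (Arg (c m) - d) else 0))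
        = (\<Sum>m\<in>{0, k}. norm (c m) * (if m = 0 then 2 * pi * cos (Arg (c m))
          else if m = k then pi * cos (Arg (c m) - d) else 0))"
      by (rule sum.mono_neutral_right) (auto simp: M_def)
    also have "\<dots> = 2 * pi * (Re (c 0) + norm (c k) / 2)"
      using k polar [of 0 0] by (simp add: d_def algebra_simps)
    finally have 1: "((\<lambda>t. S t * (1 + cos (real k * t + d))) has_integral
        2 * pi * (Re (c 0) + norm (c k) / 2)) {0..2 * pi}" .
    \<comment> \<open>Frequency and phase 0 in the kernel lemma give the mass of the kernel.\<close>
    have 2: "((\<lambda>t. (B + e) * (1 + cos (real k * t + d))) has_integral (B + e) * (2 * pi)) {0..2 * pi}"
      using has_integral_mult_right [OF has_integral_cos_kernel [OF k, of 0 0 d], of "B + e"] k by simp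
    have "2 * pi * (Re (c 0) + norm (c k) / 2) \<le> (B + e) * (2 * pi)"
    proof (rule has_integral_le [OF 1 2])
      fix t
      have "0 \<le> 1 + cos (real k * t + d)"
        using cos_ge_minus_one [of "real k * t + d"] by linarith
      then show "S t * (1 + cos (real k * t + d)) \<le> (B + e) * (1 + cos (real k * t + d))"
        by (intro mult_right_mono S_le)
    qed
    then show ?thesis
      by simp
  qed
  have "Re (c 0) + norm (c k) / 2 \<le> B"
    using main by (rule field_le_epsilon)
  then show ?thesis
    by simp
qed

section \<open>Octonion algebra and the complex planes inside it\<close>

lemmas quat_component_defs = inner_quat_def qcnj_def quat_linear_defs one_quat_def times_quat_def

lemmas octo_component_defs = inner_octo_def times_octo_def ocnj_def one_octo_def octo_linear_defs
  quat_component_defs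

lemma octo_mult_one_left: "1 * x = (x :: octo)"
  and octo_distrib_right: "(x + y) * z = x * z + y * (z :: octo)"
  and octo_distrib_left: "x * (y + z) = x * y + x * (z :: octo)"
  and octo_scaleR_left: "(r *\<^sub>R x) * y = r *\<^sub>R (x * (y :: octo))"
  and octo_scaleR_right: "x * (r *\<^sub>R y) = r *\<^sub>R (x * (y :: octo))"
  and octo_mult_one_right: "x * 1 = (x :: octo)"
  by (simp_all add: octo_component_defs octo_eq_iff quat_eq_iff algebra_simps)

text \<open>The quadratic equation of an octonion, \<open>inner 1 x\<close> being its real part. It
  makes every unit vector orthogonal to 1 a square root of -1.\<close>

lemma octo_square: "x * x = (2 * inner 1 x) *\<^sub>R x - inner x x *\<^sub>R (1 :: octo)"
  by (simp add: octo_component_defs octo_eq_iff quat_eq_iff algebra_simps)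

text \<open>Right multiplication by \<open>y\<close> has right multiplication by
  \<open>ocnj y\<close> as its adjoint; this allows moving factors across the inner product without
  associativity.\<close>

lemma inner_octo_mult_left: "inner (x * y) z = inner x (z * ocnj y)" for x y z :: octo
  by (simp add: octo_component_defs algebra_simps)

lemma norm_ocnj: "norm (ocnj x) = norm x"
  by (simp add: norm_octo_def octo_component_defs)

lemma norm_octo_one: "norm (1 :: octo) = 1"
  by (simp add: norm_octo_def octo_component_defs)

text \<open>De Moivre's formula in the plane spanned by 1 and \<open>I\<close>. Bilinearity and
  \<open>I * I = - 1\<close> suffice, since each further factor meets a power already written in
  this plane.\<close>

lemma octo_polar_power:
  assumes "I * I = - (1 :: octo)"
  shows "(cos t *\<^sub>R 1 + sin t *\<^sub>R I) ^ n = cos (real n * t) *\<^sub>R 1 + sin (real n * t) *\<^sub>R I"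
proof (induction n)
  case 0
  then show ?case by (simp add: power.power_0)
next
  case (Suc n)
  show ?case
    unfolding power.power_Suc Suc.IH
    by (simp add: octo_distrib_left octo_distrib_right octo_scaleR_left octo_scaleR_right
        octo_mult_one_left octo_mult_one_right assms algebra_simps cos_add sin_add scaleR_add_left)
qed

lemma octo_scaleR_power: "(r *\<^sub>R x) ^ n = r ^ n *\<^sub>R (x :: octo) ^ n"
  by (induction n)
     (simp_all add: power.power_0 power.power_Suc octo_scaleR_left octo_scaleR_right mult.commute)

lemma ex_octo_unit:
  obtains I :: octo where "inner 1 I = 0" "norm I = 1" "v = inner 1 v *\<^sub>R 1 + inner I v *\<^sub>R I"
proof -
  define w where "w = v - inner 1 v *\<^sub>R 1"
  have 11: "inner (1 :: octo) 1 = 1"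
    using norm_octo_one by (simp add: norm_eq_1)
  have w: "inner 1 w = 0"
    by (simp add: w_def inner_diff_right 11)
  show ?thesis
  proof (cases "w = 0")
    case True
    \<comment> \<open>Here \<open>v\<close> is real, so any unit vector orthogonal to 1 serves; this
      one is the octonion l.\<close>
    define e :: octo where "e = Octo 0 1"
    have "inner 1 e = 0" "norm e = 1"
      by (simp_all add: e_def norm_octo_def octo_component_defs)
    moreover from this True have "v = inner 1 v *\<^sub>R 1 + inner e v *\<^sub>R e"
      by (metis add.right_neutral eq_iff_diff_eq_0 inner_commute inner_scaleR_right mult_zero_right
          scaleR_zero_left w_def)
    ultimately show ?thesis
      by (rule that)
  next
    case False
    define e where "e = w /\<^sub>R norm w"
    have e: "inner 1 e = 0" "norm e = 1"
      using False w by (simp_all add: e_def)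
    have "inner e v = inner e w"
      using e(1) by (simp add: w_def inner_diff_right inner_commute)
    also have "\<dots> = norm w"
      using False by (simp add: e_def power2_norm_eq_inner [symmetric] power2_eq_square)
    finally have "v = inner 1 v *\<^sub>R 1 + inner e v *\<^sub>R e"
      using False by (simp add: e_def w_def)
    with e show ?thesis
      by (rule that)
  qed
qed

text \<open>Choose \<open>I\<close> so that \<open>v = w * ocnj b\<close> lies in the span of 1 and
  \<open>I\<close>. By adjunction its coordinates are \<open>inner b w\<close> and
  \<open>inner (I * b) w\<close>, so the complex number has modulus \<open>norm v\<close>, which is
  multiplicative. Thus projecting to the complex line of \<open>w\<close> loses no length of
  \<open>b\<close>.\<close>

lemma ex_octo_complex_line:
  fixes b w :: octo
  obtains I where "I * I = - 1" "inner 1 I = 0" "norm I = 1"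
    "norm (Complex (inner b w) (- inner (I * b) w)) = norm b * norm w"
proof -
  define v where "v = w * ocnj b"
  obtain I :: octo where I: "inner 1 I = 0" "norm I = 1"
    "v = inner 1 v *\<^sub>R 1 + inner I v *\<^sub>R I"
    by (rule ex_octo_unit)
  have II: "inner I I = 1" "inner (1 :: octo) 1 = 1"
    using I(2) norm_octo_one by (simp_all add: norm_eq_1)
  have "inner v v = (inner 1 v)\<^sup>2 + (inner I v)\<^sup>2"
    by (subst (2) I(3)) (simp add: inner_add_right inner_commute power2_eq_square)
  moreover have "inner 1 v = inner b w" "inner I v = inner (I * b) w"
    by (simp_all add: v_def inner_octo_mult_left [symmetric] octo_mult_one_left)
  ultimately have "norm (Complex (inner b w) (- inner (I * b) w)) = norm v"
    by (simp add: cmod_def norm_eq_sqrt_inner)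
  also have "\<dots> = norm b * norm w"
    by (simp add: v_def norm_octo_mult norm_ocnj)
  finally show ?thesis
    using I II octo_square [of I] by (intro that [of I]) simp_all
qed

section \<open>Coefficient bounds for octonionic power series\<close>

lemma octo_powser_norm_summable:
  fixes a :: "nat \<Rightarrow> octo"
  assumes "\<forall>x\<in>ball (0::octo) 1. (\<lambda>n. x ^ n * a n) sums f x" and r: "0 \<le> r" "r < 1"
  shows "summable (\<lambda>n. r ^ n * norm (a n))"
proof -
  \<comment> \<open>Convergence at the real point \<open>s\<close> bounds
    \<open>s ^ n * norm (a n)\<close>; the ratio \<open>r / s < 1\<close> then gives a geometric
    majorant.\<close>
  obtain s where s: "r < s" "s < 1"
    using r dense by blast
  define x :: octo where "x = s *\<^sub>R 1"
  have "x \<in> ball 0 1"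
    using s r by (simp add: x_def norm_octo_one)
  then have "summable (\<lambda>n. x ^ n * a n)"
    using assms(1) sums_summable by blast
  then have "Bseq (\<lambda>n. x ^ n * a n)"
    using summable_LIMSEQ_zero convergentI convergent_imp_Bseq by blast
  moreover have one: "(1 :: octo) ^ n = 1" for n
    by (induction n) (simp_all add: power.power_0 power.power_Suc octo_mult_one_left)
  have "norm (x ^ n * a n) = s ^ n * norm (a n)" for n
    using s r by (simp add: x_def octo_scaleR_power one norm_octo_mult norm_octo_one)
  ultimately obtain K where K: "K > 0" "\<And>n. s ^ n * norm (a n) \<le> K"
    by (auto simp: Bseq_def)
  show ?thesis
  proof (rule summable_comparison_test' [where N = 0])
    show "summable (\<lambda>n. K * (r / s) ^ n)"
      using r s by (intro summable_mult summable_geometric) simp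
  next
    fix n
    have "r ^ n * norm (a n) = (r / s) ^ n * (s ^ n * norm (a n))"
      using r s by (simp add: power_divide)
    also have "\<dots> \<le> (r / s) ^ n * K"
      using r s K(2) by (intro mult_left_mono) auto
    finally show "norm (r ^ n * norm (a n)) \<le> K * (r / s) ^ n"
      using r by (simp add: mult.commute)
  qed
qed

text \<open>On the circle of radius \<open>r\<close> in the slice of \<open>I\<close>, pairing
  \<open>f\<close> with \<open>w\<close> gives the real part of a complex power series, bounded by
  \<open>norm w\<close> through Cauchy-Schwarz. The complex coefficient estimate then
  applies.\<close>

lemma octo_powser_coeff_bound_inner:
  fixes a :: "nat \<Rightarrow> octo"
  assumes sums: "\<forall>x\<in>ball (0::octo) 1. (\<lambda>n. x ^ n * a n) sums f x"
    and bound: "\<forall>x\<in>ball 0 1. norm (f x) \<le> 1"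
    and I: "I * I = - 1" "inner 1 I = 0" "norm I = 1"
    and r: "0 \<le> r" "r < 1" and k: "k > 0"
  shows "r ^ k * norm (Complex (inner (a k) w) (- inner (I * a k) w))
    \<le> 2 * (norm w - inner (a 0) w)"
proof -
  \<comment> \<open>The minus sign matches
    \<open>Re ((p - i q) * cis s) = p * cos s + q * sin s\<close>, the pairing of
    \<open>(cos s + sin s I) * a m\<close> with \<open>w\<close> when \<open>p\<close> and
    \<open>q\<close> are the two inner products.\<close>
  define c where "c m = of_real (r ^ m) * Complex (inner (a m) w) (- inner (I * a m) w)" for m
  have sm: "summable (\<lambda>m. norm (c m))"
  proof (rule summable_comparison_test' [where N = 0])
    show "summable (\<lambda>m. (r ^ m * norm (a m)) * (2 * norm w))"
      by (intro summable_mult2 octo_powser_norm_summable [OF sums r])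
  next
    fix m
    have "norm (Complex (inner (a m) w) (- inner (I * a m) w))
        \<le> \<bar>inner (a m) w\<bar> + \<bar>inner (I * a m) w\<bar>"
      using cmod_le [of "Complex (inner (a m) w) (- inner (I * a m) w)"] by simp
    also have "\<dots> \<le> norm (a m) * norm w + norm (I * a m) * norm w"
      by (intro add_mono Cauchy_Schwarz_ineq2)
    also have "\<dots> = norm (a m) * (2 * norm w)"
      by (simp add: norm_octo_mult I)
    finally have "r ^ m * norm (Complex (inner (a m) w) (- inner (I * a m) w))
        \<le> r ^ m * (norm (a m) * (2 * norm w))"
      using r by (intro mult_left_mono) auto
    then show "norm (norm (c m)) \<le> (r ^ m * norm (a m)) * (2 * norm w)"
      using r by (simp add: c_def norm_mult norm_power mult.assoc)
  qed
  have "Re (\<Sum>m. c m * cis (real m * t)) \<le> norm w" for t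
  proof -
    define x where "x = r *\<^sub>R (cos t *\<^sub>R 1 + sin t *\<^sub>R I)"
    have II: "inner I I = 1" "inner (1 :: octo) 1 = 1"
      using I(3) norm_octo_one by (simp_all add: norm_eq_1)
    have "norm (cos t *\<^sub>R 1 + sin t *\<^sub>R I) = 1"
      unfolding norm_eq_1
      using I(2) sin_cos_squared_add [of t]
      by (simp add: inner_add_left inner_add_right inner_commute [of I 1] II power2_eq_square)
    then have x: "x \<in> ball 0 1"
      using r by (simp add: x_def)
    have coeff_eq: "inner (x ^ m * a m) w = Re (c m * cis (real m * t))" for m
      unfolding x_def octo_scaleR_power octo_polar_power [OF I(1)] octo_scaleR_left
        octo_distrib_right octo_mult_one_left c_def
      by (simp add: inner_add_left algebra_simps flip: of_real_power)
    have "(\<lambda>m. inner (x ^ m * a m) w) sums inner (f x) w"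
      using sums x by (intro bounded_linear.sums [OF bounded_linear_inner_left]) auto
    moreover have "(\<lambda>m. Re (c m * cis (real m * t))) sums Re (\<Sum>m. c m * cis (real m * t))"
      by (rule sums_Re [OF summable_sums [OF summable_norm_cancel]]) (use sm in \<open>simp add: norm_mult\<close>)
    ultimately have "Re (\<Sum>m. c m * cis (real m * t)) = inner (f x) w"
      unfolding coeff_eq by (rule sums_unique2 [rotated])
    also have "\<dots> \<le> norm (f x) * norm w"
      by (rule norm_cauchy_schwarz)
    also have "\<dots> \<le> norm w"
      using mult_right_mono [OF bspec [OF bound x], of "norm w"] by simp
    finally show ?thesis .
  qed
  from Re_bounded_imp_coeff_bound [OF sm this k] show ?thesis
    using r by (simp add: c_def norm_mult norm_power)
qed

text \<open>With \<open>w\<close> along \<open>a 0\<close> and \<open>I\<close> adapted to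
  \<open>a k\<close> and \<open>w\<close>, both coefficients project without loss; dividing by
  \<open>norm w\<close> and letting \<open>r\<close> tend to 1 gives the bound.\<close>

lemma octo_powser_coeff_bound:
  fixes a :: "nat \<Rightarrow> octo"
  assumes sums: "\<forall>x\<in>ball (0::octo) 1. (\<lambda>n. x ^ n * a n) sums f x"
    and bound: "\<forall>x\<in>ball 0 1. norm (f x) \<le> 1"
    and k: "k > 0"
  shows "norm (a k) \<le> 2 * (1 - norm (a 0))"
proof (cases "a 0 = 0 \<and> a k = 0")
  case False
  \<comment> \<open>If \<open>a 0 = 0\<close>, its projection is zero for every \<open>w\<close>, so
    the nonzero vector \<open>a k\<close> can be taken.\<close>
  define w where "w = (if a 0 = 0 then a k else a 0)"
  have w: "norm w > 0" "inner (a 0) w = norm (a 0) * norm w"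
    using False by (auto simp: w_def norm_eq_sqrt_inner)
  obtain I where I: "I * I = - 1" "inner 1 I = 0" "norm I = 1"
    "norm (Complex (inner (a k) w) (- inner (I * a k) w)) = norm (a k) * norm w"
    by (rule ex_octo_complex_line)
  have le: "r ^ k * norm (a k) \<le> 2 * (1 - norm (a 0))" if "r \<in> {0<..<1}" for r
  proof -
    have "r ^ k * (norm (a k) * norm w) \<le> 2 * (norm w - norm (a 0) * norm w)"
      using octo_powser_coeff_bound_inner [OF sums bound I(1-3) _ _ k, of r w] that I(4) w(2)
      by simp
    then have "(r ^ k * norm (a k)) * norm w \<le> (2 * (1 - norm (a 0))) * norm w"
      by (simp add: algebra_simps)
    then show ?thesis
      using w(1) by simp
  qed
  have "((\<lambda>r. r ^ k * norm (a k)) \<longlongrightarrow> 1 ^ k * norm (a k)) (at_left (1 :: real))"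
    by (intro tendsto_intros)
  moreover have "\<forall>\<^sub>F r in at_left (1 :: real). r ^ k * norm (a k) \<le> 2 * (1 - norm (a 0))"
    using eventually_at_left_real [of 0 1] by (rule eventually_mono) (use le in auto)
  ultimately show ?thesis
    using tendsto_upperbound by fastforce
qed simp

section \<open>Comparison with the logarithmic series\<close>

lemma sum_power_inverse_le_half: "(\<Sum>k=1..n. (1 / (real n + 1)) ^ k) \<le> 1 / 2"
proof (cases "n \<le> 1")
  case True
  then have "n = 0 \<or> n = 1"
    by linarith
  then show ?thesis
    by auto
next
  \<comment> \<open>The geometric majorant \<open>q / (1 - q)\<close> equals \<open>1 / n\<close>,
    which is at most 1/2 only from \<open>n = 2\<close> on; at \<open>n = 1\<close> the sum itself
    is exactly 1/2.\<close>
  case False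
  define q where "q = 1 / (real n + 1)"
  have q: "0 < q" "q \<le> 1 / 3"
    using False by (simp_all add: q_def field_simps)
  have "(\<Sum>k=1..n. q ^ k) = (q - q ^ Suc n) / (1 - q)"
    using q False sum_gp [of q 1 n] by simp
  also have "\<dots> \<le> q / (1 - q)"
    using q by (intro divide_right_mono) auto
  also have "\<dots> \<le> 1 / 2"
    using q by (simp add: field_simps)
  finally show ?thesis
    by (simp add: q_def)
qed

theorem theorem2p4:
  fixes f :: "octo \<Rightarrow> octo" and a :: "nat \<Rightarrow> octo"
  assumes "f \<in> SRB"
    and "\<forall>x\<in>ball (0::octo) 1. (\<lambda>n. x ^ n * a n) sums f x"
  shows "\<forall>x\<in>ball (0::octo) 1. 0 < norm x \<longrightarrow>
    summable (\<lambda>n. norm x ^ n * (\<Sum>k=0..n. norm (a k) / (real n + 1) ^ (k + 1))) \<and>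
    (\<Sum>n. norm x ^ n * (\<Sum>k=0..n. norm (a k) / (real n + 1) ^ (k + 1)))
      \<le> 1 / norm x * ln (1 / (1 - norm x))"
proof (intro ballI impI)
  fix x :: octo
  assume x: "x \<in> ball 0 1" "0 < norm x"
  define r where "r = norm x"
  have r: "0 < r" "r < 1"
    using x by (simp_all add: r_def)
  have bound: "\<forall>y\<in>ball 0 1. norm (f y) \<le> 1"
    using assms(1) by (simp add: SRB_def)
  note coeff = octo_powser_coeff_bound [OF assms(2) bound]
  \<comment> \<open>Read off from
    \<open>0 \<le> norm (a 1) \<le> 2 * (1 - norm (a 0))\<close>.\<close>
  have a0: "norm (a 0) \<le> 1"
    using order_trans [OF norm_ge_zero coeff [OF zero_less_one]] by simp
  have inner_sum: "(\<Sum>k=0..n. norm (a k) / (real n + 1) ^ (k + 1)) \<le> 1 / (real n + 1)" for n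
  proof -
    define q where "q = 1 / (real n + 1)"
    have q: "q > 0"
      by (simp add: q_def)
    have "(\<Sum>k=0..n. norm (a k) * q ^ k) = norm (a 0) + (\<Sum>k=1..n. norm (a k) * q ^ k)"
      by (simp add: sum.atLeast_Suc_atMost)
    also have "(\<Sum>k=1..n. norm (a k) * q ^ k) \<le> (\<Sum>k=1..n. 2 * (1 - norm (a 0)) * q ^ k)"
      using q by (intro sum_mono mult_right_mono coeff) auto
    also have "\<dots> = 2 * (1 - norm (a 0)) * (\<Sum>k=1..n. q ^ k)"
      by (simp add: sum_distrib_left)
    \<comment> \<open>The 1/2 cancels the factor 2 of the coefficient bound, so the terms with
      \<open>k \<ge> 1\<close> add at most what \<open>norm (a 0)\<close> leaves below 1.\<close>
    also have "\<dots> \<le> 2 * (1 - norm (a 0)) * (1 / 2)"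
      using a0 sum_power_inverse_le_half [of n] by (intro mult_left_mono) (simp_all add: q_def)
    also have "\<dots> = 1 - norm (a 0)"
      by simp
    finally have le1: "(\<Sum>k=0..n. norm (a k) * q ^ k) \<le> 1"
      by simp
    have "(\<Sum>k=0..n. norm (a k) / (real n + 1) ^ (k + 1)) = q * (\<Sum>k=0..n. norm (a k) * q ^ k)"
      unfolding sum_distrib_left by (rule sum.cong) (simp_all add: q_def power_divide)
    also have "\<dots> \<le> q * 1"
      using q le1 by (intro mult_left_mono) auto
    finally show ?thesis
      by (simp add: q_def)
  qed
  have term_le: "r ^ n * (\<Sum>k=0..n. norm (a k) / (real n + 1) ^ (k + 1)) \<le> r ^ n / (real n + 1)" for n
    using mult_left_mono [OF inner_sum [of n], of "r ^ n"] r by simp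
  have "(\<lambda>n. - (r ^ n) / real n) sums ln (1 - r)"
    using ln_series' [of "- r"] r by simp
  \<comment> \<open>The shift drops the term at \<open>n = 0\<close>, which is 0 because division by
    zero yields 0.\<close>
  then have "(\<lambda>n. - (r ^ Suc n) / real (Suc n)) sums ln (1 - r)"
    by (subst sums_Suc_iff) simp
  from sums_mult [OF this, of "- 1 / r"]
  have log_sums: "(\<lambda>n. r ^ n / (real n + 1)) sums (1 / r * ln (1 / (1 - r)))"
    using r by (simp add: ln_div field_simps)
  have sm: "summable (\<lambda>n. r ^ n * (\<Sum>k=0..n. norm (a k) / (real n + 1) ^ (k + 1)))"
  proof (rule summable_comparison_test' [OF sums_summable [OF log_sums], where N = 0])
    fix n
    have "0 \<le> r ^ n * (\<Sum>k=0..n. norm (a k) / (real n + 1) ^ (k + 1))"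
      using r by (intro mult_nonneg_nonneg sum_nonneg divide_nonneg_nonneg) auto
    then show "norm (r ^ n * (\<Sum>k=0..n. norm (a k) / (real n + 1) ^ (k + 1))) \<le> r ^ n / (real n + 1)"
      using term_le [of n] by simp
  qed
  show "summable (\<lambda>n. norm x ^ n * (\<Sum>k=0..n. norm (a k) / (real n + 1) ^ (k + 1))) \<and>
    (\<Sum>n. norm x ^ n * (\<Sum>k=0..n. norm (a k) / (real n + 1) ^ (k + 1)))
      \<le> 1 / norm x * ln (1 / (1 - norm x))"
    using sm suminf_le [OF term_le sm sums_summable [OF log_sums]] sums_unique [OF log_sums]
    unfolding r_def by simp
qed

end
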